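(* Let $R$ be a ring that satisfies property $(\star)$, exhibited by $\mathfrak{m}\in\mathrm{Max}(R)$ and a field $\kappa\subseteq R$. Then for every ring $S$ and all maps $\lambda\colon R\to\mathrm{End}(S_S)$, $\rho\colon R\to\mathrm{End}({}_SS)$ (both preserving $1$) defining a semidirect product $S\rtimes_{\lambda,\rho}R$, the ring $S\rtimes_{\lambda,\rho}R$ satisfies property $(\star)$. More precisely, property $(\star)$ for $S\rtimes_{\lambda,\rho}R$ is exhibited by the maximal ideal $S\rtimes_{\lambda',\rho'}\mathfrak{m}=\{(s,x): s\in S,\ x\in\mathfrak{m}\}$, where $\lambda'$ and $\rho'$ are the restrictions of $\lambda$ and $\rho$ to $\mathfrak{m}$, and by the same field $\kappa$ (embedded as $\{(0,u): u\in\kappa\}$).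
   Context: Conventions: rings are associative and unitary (not necessarily commutative) unless stated otherwise, ring homomorphisms preserve $1$, ideals are two-sided, and subrings and subfields share the same $1$. Fields are commutative. $\mathrm{Max}(R)$ is the set of maximal ideals of $R$. Property $(\star)$ for a ring $R$: there exists a maximal ideal $\mathfrak{m}$ of $R$ such that the canonical projection $\pi\colon R\to R/\mathfrak{m}$ has a section, so that $R/\mathfrak{m}$ is isomorphic to a field $\kappa$ contained in $R$. One says that $\mathfrak{m}\in\mathrm{Max}(R)$ and a field $\kappa\subseteq R$ exhibit property $(\star)$ for $R$ if there is a ring isomorphism $j\colon R/\mathfrak{m}\to\kappa$ such that the composite $s\colon R/\mathfrak{m}\xrightarrow{j}\kappa\subseteq R$ satisfies $\pi\circ s=\mathrm{id}$. Semidirect product: let $B,T$ be associative, not necessarily unitary rings. Let $\lambda\colon T\to\mathrm{End}(B_B)$ be a ring homomorphism (endomorphisms of $B$ as a right $B$-module: additive maps $f$ with $f(xy)=f(x)y$) and $\rho\colon T\to\mathrm{End}({}_BB)$ a ring anti-homomorphism (endomorphisms of $B$ as a left $B$-module: additive maps $f$ with $f(xy)=xf(y)$) such that for all $s,t\in T$, $x,y\in B$: $\lambda(s)\circ\rho(t)=\rho(t)\circ\lambda(s)$ and $\rho(s)(x)\cdot y=x\cdot\lambda(s)(y)$. Then $B\rtimes_{\lambda,\rho}T$ is the not necessarily unitary ring with additive group $B\oplus T$ and product $(b,s)\cdot(c,t)=(bc+\lambda(s)(c)+\rho(t)(b),\,st)$. Whenever $T$ has a $1$, it is assumed that $\lambda$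 and $\rho$ preserve $1$, so that $B\rtimes_{\lambda,\rho}T$ is unitary with $1=(0,1)$ and contains a copy $\{(0,t)\}$ of $T$. *)

theory Defs
  imports "HOL-Algebra.QuotRing" "HOL-Algebra.Subrings"
begin

section \<open>Not necessarily unitary rings\<close>

text \<open>
  The field \<open>one\<close> of the record carries no meaning here, so that for example
  \<open>R\<lparr>carrier := I\<rparr>\<close> is such a ring for every ideal \<open>I\<close> of \<open>R\<close>.
\<close>

locale nonunital_ring = abelian_group R for R (structure) +
  assumes m_closed: "\<lbrakk> x \<in> carrier R; y \<in> carrier R \<rbrakk> \<Longrightarrow> x \<otimes> y \<in> carrier R"
    and m_assoc: "\<lbrakk> x \<in> carrier R; y \<in> carrier R; z \<in> carrier R \<rbrakk>
      \<Longrightarrow> (x \<otimes> y) \<otimes> z = x \<otimes> (y \<otimes> z)"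
    and l_distr: "\<lbrakk> x \<in> carrier R; y \<in> carrier R; z \<in> carrier R \<rbrakk>
      \<Longrightarrow> (x \<oplus> y) \<otimes> z = x \<otimes> z \<oplus> y \<otimes> z"
    and r_distr: "\<lbrakk> x \<in> carrier R; y \<in> carrier R; z \<in> carrier R \<rbrakk>
      \<Longrightarrow> z \<otimes> (x \<oplus> y) = z \<otimes> x \<oplus> z \<otimes> y"

definition nonunital_ring_hom ::
    "('a, 'm) ring_scheme \<Rightarrow> ('b, 'n) ring_scheme \<Rightarrow> ('a \<Rightarrow> 'b) set"
  where "nonunital_ring_hom R S =
    {h \<in> carrier R \<rightarrow> carrier S. \<forall>x \<in> carrier R. \<forall>y \<in> carrier R.
       h (x \<oplus>\<^bsub>R\<^esub> y) = h x \<oplus>\<^bsub>S\<^esub> h y \<and> h (x \<otimes>\<^bsub>R\<^esub> y) = h x \<otimes>\<^bsub>S\<^esub> h y}"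

definition nonunital_ring_antihom ::
    "('a, 'm) ring_scheme \<Rightarrow> ('b, 'n) ring_scheme \<Rightarrow> ('a \<Rightarrow> 'b) set"
  where "nonunital_ring_antihom R S =
    {h \<in> carrier R \<rightarrow> carrier S. \<forall>x \<in> carrier R. \<forall>y \<in> carrier R.
       h (x \<oplus>\<^bsub>R\<^esub> y) = h x \<oplus>\<^bsub>S\<^esub> h y \<and> h (x \<otimes>\<^bsub>R\<^esub> y) = h y \<otimes>\<^bsub>S\<^esub> h x}"


section \<open>Endomorphism rings of the right and the left regular module\<close>

text \<open>
  Endomorphisms are represented by functions that are \<open>undefined\<close> outside the carrier,
  so that equality in these rings is pointwise equality on the carrier.
  The multiplication is composition: \<open>f \<otimes> g\<close> maps \<open>x\<close> to \<open>f (g x)\<close>.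
\<close>

definition additive_maps :: "('a, 'm) ring_scheme \<Rightarrow> ('a \<Rightarrow> 'a) set"
  where "additive_maps B =
    {f \<in> carrier B \<rightarrow>\<^sub>E carrier B. \<forall>x \<in> carrier B. \<forall>y \<in> carrier B.
       f (x \<oplus>\<^bsub>B\<^esub> y) = f x \<oplus>\<^bsub>B\<^esub> f y}"

definition End_right :: "('a, 'm) ring_scheme \<Rightarrow> ('a \<Rightarrow> 'a) ring"
  where "End_right B =
    \<lparr>carrier = {f \<in> additive_maps B. \<forall>x \<in> carrier B. \<forall>y \<in> carrier B.
        f (x \<otimes>\<^bsub>B\<^esub> y) = f x \<otimes>\<^bsub>B\<^esub> y},
     mult = compose (carrier B),
     one = (\<lambda>x \<in> carrier B. x),
     zero = (\<lambda>x \<in> carrier B. \<zero>\<^bsub>B\<^esub>),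
     add = (\<lambda>f g. \<lambda>x \<in> carrier B. f x \<oplus>\<^bsub>B\<^esub> g x)\<rparr>"

definition End_left :: "('a, 'm) ring_scheme \<Rightarrow> ('a \<Rightarrow> 'a) ring"
  where "End_left B =
    \<lparr>carrier = {f \<in> additive_maps B. \<forall>x \<in> carrier B. \<forall>y \<in> carrier B.
        f (x \<otimes>\<^bsub>B\<^esub> y) = x \<otimes>\<^bsub>B\<^esub> f y},
     mult = compose (carrier B),
     one = (\<lambda>x \<in> carrier B. x),
     zero = (\<lambda>x \<in> carrier B. \<zero>\<^bsub>B\<^esub>),
     add = (\<lambda>f g. \<lambda>x \<in> carrier B. f x \<oplus>\<^bsub>B\<^esub> g x)\<rparr>"


section \<open>Semidirect products\<close>

text \<open>
  Preservation of \<open>1\<close> is not part of this locale, because it is meant to apply also to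
  actions of ideals; for unitary \<open>T\<close> it has to be assumed in addition.
\<close>

locale semidirect_data = B: nonunital_ring B + T: nonunital_ring T
  for B :: "('b, 'm) ring_scheme" and T :: "('t, 'n) ring_scheme"
    and lam :: "'t \<Rightarrow> 'b \<Rightarrow> 'b" and rho :: "'t \<Rightarrow> 'b \<Rightarrow> 'b" +
  assumes lam_hom: "lam \<in> nonunital_ring_hom T (End_right B)"
    and rho_antihom: "rho \<in> nonunital_ring_antihom T (End_left B)"
    and lam_rho_commute: "\<lbrakk> s \<in> carrier T; t \<in> carrier T; x \<in> carrier B \<rbrakk>
      \<Longrightarrow> lam s (rho t x) = rho t (lam s x)"
    and rho_lam_balanced: "\<lbrakk> s \<in> carrier T; x \<in> carrier B; y \<in> carrier B \<rbrakk>
      \<Longrightarrow> rho s x \<otimes>\<^bsub>B\<^esub> y = x \<otimes>\<^bsub>B\<^esub> lam s y"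

definition semidirect ::
    "('b, 'm) ring_scheme \<Rightarrow> ('t, 'n) ring_scheme \<Rightarrow> ('t \<Rightarrow> 'b \<Rightarrow> 'b) \<Rightarrow> ('t \<Rightarrow> 'b \<Rightarrow> 'b)
      \<Rightarrow> ('b \<times> 't) ring"
  where "semidirect B T lam rho =
    \<lparr>carrier = carrier B \<times> carrier T,
     mult = (\<lambda>(b, s) (c, t). (b \<otimes>\<^bsub>B\<^esub> c \<oplus>\<^bsub>B\<^esub> lam s c \<oplus>\<^bsub>B\<^esub> rho t b, s \<otimes>\<^bsub>T\<^esub> t)),
     one = (\<zero>\<^bsub>B\<^esub>, \<one>\<^bsub>T\<^esub>),
     zero = (\<zero>\<^bsub>B\<^esub>, \<zero>\<^bsub>T\<^esub>),
     add = (\<lambda>(b, s) (c, t). (b \<oplus>\<^bsub>B\<^esub> c, s \<oplus>\<^bsub>T\<^esub> t))\<rparr>"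


section \<open>Property \<open>(\<star>)\<close>\<close>

text \<open>
  The last clause says \<open>\<pi> \<circ> s = id\<close>, where \<open>\<pi> x = m +>\<^bsub>R\<^esub> x\<close> is the canonical
  projection and \<open>s\<close> is \<open>j\<close> followed by the inclusion of \<open>K\<close> in \<open>R\<close>.
\<close>

definition exhibits_star :: "('a, 'm) ring_scheme \<Rightarrow> 'a set \<Rightarrow> 'a set \<Rightarrow> bool"
  where "exhibits_star R m K \<longleftrightarrow>
    maximalideal m R \<and> subfield K R \<and>
    (\<exists>j \<in> ring_iso (R Quot m) (R\<lparr>carrier := K\<rparr>).
       \<forall>X \<in> carrier (R Quot m). m +>\<^bsub>R\<^esub> j X = X)"

definition property_star :: "('a, 'm) ring_scheme \<Rightarrow> bool"
  where "property_star R \<longleftrightarrow> (\<exists>m K. exhibits_star R m K)"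

end

theory Submission
  imports Defs
begin

text \<open>
  If \<open>m\<close> is a maximal ideal and \<open>K\<close> a subfield of \<open>R\<close>, then \<open>K \<rightarrow> R/m\<close> is automatically injective,
  so \<open>m\<close> and \<open>K\<close> exhibit property \<open>(\<star>)\<close> exactly when \<open>K\<close> meets every coset of \<open>m\<close>. In this form
  the property pulls back along every surjective ring homomorphism \<open>p\<close> with a section \<open>i\<close>: the
  ideal becomes the preimage of \<open>m\<close> under \<open>p\<close>, and the field becomes \<open>i ` K\<close>. The theorem is the
  case of the projection of the semidirect product to \<open>R\<close> with the section \<open>u \<mapsto> (0, u)\<close>.
\<close>

section \<open>Property \<open>(\<star>)\<close> and retractions\<close>

text \<open>From left to right, \<open>u = j (m +> x)\<close> works. Conversely, the projection
  restricted to \<open>K\<close> is injective because \<open>K\<close> is a field and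
  \<open>R Quot m\<close> is nonzero, and it is onto because \<open>K\<close> meets every coset; its
  inverse serves as \<open>j\<close>.\<close>

lemma exhibits_star_iff:
  fixes R (structure)
  assumes "ring R"
  shows "exhibits_star R m K \<longleftrightarrow> maximalideal m R \<and> subfield K R \<and>
    (\<forall>x \<in> carrier R. \<exists>u \<in> K. m +> u = m +> x)"
proof -
  interpret ring R by fact
  have Quot_carrier: "carrier (R Quot m) = (\<lambda>x. m +> x) ` carrier R"
    by (auto simp: FactRing_def A_RCOSETS_def')
  have "(\<exists>j \<in> ring_iso (R Quot m) (R\<lparr>carrier := K\<rparr>). \<forall>X \<in> carrier (R Quot m). m +> j X = X) \<longleftrightarrow>
    (\<forall>x \<in> carrier R. \<exists>u \<in> K. m +> u = m +> x)"
    if m: "maximalideal m R" and K: "subfield K R"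
  proof
    assume "\<exists>j \<in> ring_iso (R Quot m) (R\<lparr>carrier := K\<rparr>). \<forall>X \<in> carrier (R Quot m). m +> j X = X"
    then obtain j where j: "j \<in> ring_iso (R Quot m) (R\<lparr>carrier := K\<rparr>)"
      "\<And>X. X \<in> carrier (R Quot m) \<Longrightarrow> m +> j X = X"
      by blast
    show "\<forall>x \<in> carrier R. \<exists>u \<in> K. m +> u = m +> x"
    proof
      fix x assume "x \<in> carrier R"
      then have x: "m +> x \<in> carrier (R Quot m)" unfolding Quot_carrier by blast
      show "\<exists>u \<in> K. m +> u = m +> x"
        using ring_iso_memE(1)[OF j(1) x] j(2)[OF x] by auto
    qed
  next
    assume meets: "\<forall>x \<in> carrier R. \<exists>u \<in> K. m +> u = m +> x"
    interpret m: maximalideal m R by fact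
    have K_sub: "K \<subseteq> carrier R" by (rule subfieldE(3)[OF K])
    \<comment> \<open>Otherwise \<open>m\<close> would contain \<one> and be all of
      \<open>R\<close>. The quotient is therefore nonzero, which forces a homomorphism from a field
      into it to be injective.\<close>
    have "m +> \<one> \<noteq> m"
      using m.rcos_const_imp_mem[OF one_closed] m.one_imp_carrier m.I_notcarr by metis
    then have nontrivial: "\<one>\<^bsub>R Quot m\<^esub> \<noteq> \<zero>\<^bsub>R Quot m\<^esub>"
      by (simp add: FactRing_def)
    interpret pi: ring_hom_ring R "R Quot m" "(+>) m" by (rule m.rcos_ring_hom_ring)
    have inj: "inj_on ((+>) m) K"
      by (rule pi.img_is_subfield(1)[OF K nontrivial])
    have img: "(+>) m ` K = carrier (R Quot m)"
      unfolding Quot_carrier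
    proof
      show "(+>) m ` K \<subseteq> (+>) m ` carrier R" using K_sub by blast
      show "(+>) m ` carrier R \<subseteq> (+>) m ` K" using meets by (metis image_eqI image_subsetI)
    qed
    \<comment> \<open>In this direction the homomorphism laws are those of the projection; the
      inverse inherits them.\<close>
    have "(+>) m \<in> ring_iso (R\<lparr>carrier := K\<rparr>) (R Quot m)"
    proof (rule ring_iso_memI)
      show "bij_betw ((+>) m) (carrier (R\<lparr>carrier := K\<rparr>)) (carrier (R Quot m))"
        using inj img by (simp add: bij_betw_def)
    qed (simp_all add: subsetD[OF K_sub])
    moreover have "ring (R\<lparr>carrier := K\<rparr>)"
      by (rule subring_is_ring[OF subfieldE(1)[OF K]])
    ultimately have "inv_into K ((+>) m) \<in> ring_iso (R Quot m) (R\<lparr>carrier := K\<rparr>)"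
      using ring_iso_set_sym by fastforce
    moreover have "m +> inv_into K ((+>) m) X = X" if "X \<in> carrier (R Quot m)" for X
      using that img by (simp add: f_inv_into_f)
    ultimately show "\<exists>j \<in> ring_iso (R Quot m) (R\<lparr>carrier := K\<rparr>).
        \<forall>X \<in> carrier (R Quot m). m +> j X = X"
      by blast
  qed
  then show ?thesis
    unfolding exhibits_star_def by blast
qed

section \<open>Pulling ideals and property (\<star>) back along surjective homomorphisms\<close>

context ring_hom_ring
begin

text \<open>Surjectivity serves absorption: a multiplier from \<open>S\<close> lifts to
  \<open>R\<close>, where \<open>J\<close> absorbs it.\<close>

lemma surj_img_is_ideal:
  assumes surj: "h ` carrier R = carrier S" and "ideal J R"
  shows "ideal (h ` J) S"
proof -
  interpret J: ideal J R by fact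
  show ?thesis
  proof (rule idealI)
    show "ring S" by (rule S.ring_axioms)
    show "subgroup (h ` J) (add_monoid S)"
      by (rule img_is_add_subgroup[OF J.a_subgroup])
  next
    fix a x assume "a \<in> h ` J" "x \<in> carrier S"
    then obtain b y where "b \<in> J" "a = h b" "y \<in> carrier R" "x = h y"
      using surj by (metis imageE)
    then show "x \<otimes>\<^bsub>S\<^esub> a \<in> h ` J" "a \<otimes>\<^bsub>S\<^esub> x \<in> h ` J"
      using J.I_l_closed[of b y] J.I_r_closed[of b y] J.Icarr[of b] by (metis hom_mult image_eqI)+
  qed
qed

text \<open>An ideal \<open>J\<close> above the preimage has an image above \<open>m\<close>, so
  this image is \<open>m\<close> or all of \<open>S\<close>. Since \<open>J\<close> contains the
  kernel of \<open>h\<close>, it is determined by its image.\<close>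

lemma maximalideal_vimage:
  assumes surj: "h ` carrier R = carrier S" and "maximalideal m S"
  shows "maximalideal {x \<in> carrier R. h x \<in> m} R" (is "maximalideal ?I R")
proof -
  interpret m: maximalideal m S by fact
  show ?thesis
  proof (rule maximalidealI)
    show "ideal ?I R" by (rule ideal_vimage[OF m.is_ideal])
    show "carrier R \<noteq> ?I"
    proof
      assume "carrier R = ?I"
      then have "h ` carrier R \<subseteq> m" by blast
      then show False unfolding surj using m.I_notcarr m.a_subset by blast
    qed
  next
    fix J assume J: "ideal J R" and IJ: "?I \<subseteq> J" and JR: "J \<subseteq> carrier R"
    interpret J: ideal J R by fact
    have "ideal (h ` J) S"
      by (rule surj_img_is_ideal[OF surj J])
    moreover have "m \<subseteq> h ` J"
    proof
      fix y assume "y \<in> m"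
      moreover from this obtain x where "x \<in> carrier R" "y = h x"
        using surj m.Icarr by blast
      ultimately show "y \<in> h ` J" using IJ by auto
    qed
    moreover have "h ` J \<subseteq> carrier S" using JR by auto
    ultimately consider "h ` J = m" | "h ` J = carrier S"
      using m.I_maximal by blast
    then show "J = ?I \<or> J = carrier R"
    proof cases
      case 1
      then show ?thesis using IJ JR by blast
    next
      case 2
      \<comment> \<open>Some \<open>y\<close> in \<open>J\<close> has the same image as
        \<open>x\<close>. Their difference lies in the kernel, hence in the preimage of
        \<open>m\<close>, hence in \<open>J\<close>.\<close>
      have "x \<in> J" if x: "x \<in> carrier R" for x
      proof -
        obtain y where y: "y \<in> J" "h y = h x"
          using 2 x hom_closed by (metis imageE)
        then have yR: "y \<in> carrier R" by (simp add: J.Icarr)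
        have "h (x \<ominus> y) = \<zero>\<^bsub>S\<^esub>"
          using x yR y(2) by (simp add: R.minus_eq S.r_neg)
        then have "x \<ominus> y \<in> J" using IJ x yR m.zero_closed by auto
        then have "(x \<ominus> y) \<oplus> y \<in> J" using y(1) by blast
        then show ?thesis
          using x yR by (simp add: R.minus_eq R.a_assoc R.l_neg)
      qed
      then show ?thesis using JR by blast
    qed
  qed
qed

text \<open>The section \<open>i\<close> makes \<open>h\<close> surjective, so the preimage of
  \<open>m\<close> is maximal. To meet the coset of \<open>x\<close>, choose \<open>u\<close> in
  \<open>K\<close> congruent to \<open>h x\<close> modulo \<open>m\<close>; then \<open>i u\<close>
  is congruent to \<open>x\<close> modulo the preimage.\<close>

lemma exhibits_star_vimage:
  assumes star: "exhibits_star S m K"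
    and i: "i \<in> ring_hom S R" and retract: "\<And>y. y \<in> carrier S \<Longrightarrow> h (i y) = y"
  shows "exhibits_star R {x \<in> carrier R. h x \<in> m} (i ` K)" (is "exhibits_star R ?I _")
proof -
  have m: "maximalideal m S" and K: "subfield K S"
    and meets: "\<forall>y \<in> carrier S. \<exists>u \<in> K. m +>\<^bsub>S\<^esub> u = m +>\<^bsub>S\<^esub> y"
    using star by (simp_all add: exhibits_star_iff[OF S.ring_axioms])
  interpret m: maximalideal m S by (rule m)
  interpret i: ring_hom_ring S R i by (rule ring_hom_ringI2[OF S.ring_axioms R.ring_axioms i])
  have surj: "h ` carrier R = carrier S"
  proof
    show "carrier S \<subseteq> h ` carrier R"
    proof
      fix y assume "y \<in> carrier S"
      then show "y \<in> h ` carrier R"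
        by (intro image_eqI[of _ _ "i y"]) (simp_all add: retract)
    qed
  qed auto
  have K_sub: "K \<subseteq> carrier S" by (rule subfieldE(3)[OF K])
  \<comment> \<open>If \<open>R\<close> were zero, applying \<open>h\<close> would give \<one> =
    \<zero> in \<open>S\<close>, which has a subfield. With \<open>R\<close> nonzero,
    \<open>i\<close> embeds the field \<open>K\<close>.\<close>
  have "\<one> \<noteq> \<zero>"
    using subfieldE(6)[OF K] hom_one hom_zero by metis
  then have "subfield (i ` K) R"
    by (rule i.img_is_subfield(2)[OF K])
  moreover have maxI: "maximalideal ?I R"
    by (rule maximalideal_vimage[OF surj m])
  moreover have "\<exists>u \<in> i ` K. ?I +> u = ?I +> x" if x: "x \<in> carrier R" for x
  proof -
    obtain u where u: "u \<in> K" "m +>\<^bsub>S\<^esub> u = m +>\<^bsub>S\<^esub> h x"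
      using meets x hom_closed by blast
    then have uS: "u \<in> carrier S" using K_sub by blast
    have "u \<ominus>\<^bsub>S\<^esub> h x \<in> m"
      using u(2) S.quotient_eq_iff_same_a_r_cos[OF m.is_ideal uS] x by simp
    then have "i u \<ominus> x \<in> ?I"
      using x uS retract by (simp add: R.minus_eq S.minus_eq)
    then have "?I +> i u = ?I +> x"
      using R.quotient_eq_iff_same_a_r_cos[OF maximalideal.axioms(1)[OF maxI] i.hom_closed[OF uS] x]
      by (rule iffD1[rotated])
    then show ?thesis using u(1) by blast
  qed
  ultimately show ?thesis
    by (simp add: exhibits_star_iff[OF R.ring_axioms])
qed

end


section \<open>Semidirect products\<close>

context semidirect_data
begin

section \<open>Pointwise laws of the two actions\<close>

lemma lam_End_right: "s \<in> carrier T \<Longrightarrow> lam s \<in> carrier (End_right B)"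
  using lam_hom by (auto simp: nonunital_ring_hom_def)

lemma rho_End_left: "s \<in> carrier T \<Longrightarrow> rho s \<in> carrier (End_left B)"
  using rho_antihom by (auto simp: nonunital_ring_antihom_def)

lemma lam_closed [simp]: "\<lbrakk> s \<in> carrier T; x \<in> carrier B \<rbrakk> \<Longrightarrow> lam s x \<in> carrier B"
  using lam_End_right[of s] by (auto simp: End_right_def additive_maps_def)

lemma rho_closed [simp]: "\<lbrakk> s \<in> carrier T; x \<in> carrier B \<rbrakk> \<Longrightarrow> rho s x \<in> carrier B"
  using rho_End_left[of s] by (auto simp: End_left_def additive_maps_def)

lemma lam_add: "\<lbrakk> s \<in> carrier T; x \<in> carrier B; y \<in> carrier B \<rbrakk>
    \<Longrightarrow> lam s (x \<oplus>\<^bsub>B\<^esub> y) = lam s x \<oplus>\<^bsub>B\<^esub> lam s y"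
  using lam_End_right by (auto simp: End_right_def additive_maps_def)

lemma rho_add: "\<lbrakk> s \<in> carrier T; x \<in> carrier B; y \<in> carrier B \<rbrakk>
    \<Longrightarrow> rho s (x \<oplus>\<^bsub>B\<^esub> y) = rho s x \<oplus>\<^bsub>B\<^esub> rho s y"
  using rho_End_left by (auto simp: End_left_def additive_maps_def)

lemma lam_mult: "\<lbrakk> s \<in> carrier T; x \<in> carrier B; y \<in> carrier B \<rbrakk>
    \<Longrightarrow> lam s (x \<otimes>\<^bsub>B\<^esub> y) = lam s x \<otimes>\<^bsub>B\<^esub> y"
  using lam_End_right by (auto simp: End_right_def)

lemma rho_mult: "\<lbrakk> s \<in> carrier T; x \<in> carrier B; y \<in> carrier B \<rbrakk>
    \<Longrightarrow> rho s (x \<otimes>\<^bsub>B\<^esub> y) = x \<otimes>\<^bsub>B\<^esub> rho s y"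
  using rho_End_left by (auto simp: End_left_def)

lemma lam_add_scalar: "\<lbrakk> s \<in> carrier T; t \<in> carrier T; x \<in> carrier B \<rbrakk>
    \<Longrightarrow> lam (s \<oplus>\<^bsub>T\<^esub> t) x = lam s x \<oplus>\<^bsub>B\<^esub> lam t x"
  using lam_hom by (auto simp: nonunital_ring_hom_def End_right_def)

lemma rho_add_scalar: "\<lbrakk> s \<in> carrier T; t \<in> carrier T; x \<in> carrier B \<rbrakk>
    \<Longrightarrow> rho (s \<oplus>\<^bsub>T\<^esub> t) x = rho s x \<oplus>\<^bsub>B\<^esub> rho t x"
  using rho_antihom by (auto simp: nonunital_ring_antihom_def End_left_def)

lemma lam_mult_scalar: "\<lbrakk> s \<in> carrier T; t \<in> carrier T; x \<in> carrier B \<rbrakk>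
    \<Longrightarrow> lam (s \<otimes>\<^bsub>T\<^esub> t) x = lam s (lam t x)"
  using lam_hom by (auto simp: nonunital_ring_hom_def End_right_def compose_def)

lemma rho_mult_scalar: "\<lbrakk> s \<in> carrier T; t \<in> carrier T; x \<in> carrier B \<rbrakk>
    \<Longrightarrow> rho (s \<otimes>\<^bsub>T\<^esub> t) x = rho t (rho s x)"
  using rho_antihom by (auto simp: nonunital_ring_antihom_def End_left_def compose_def)

lemma lam_zero [simp]: "s \<in> carrier T \<Longrightarrow> lam s \<zero>\<^bsub>B\<^esub> = \<zero>\<^bsub>B\<^esub>"
  using lam_add[of s "\<zero>\<^bsub>B\<^esub>" "\<zero>\<^bsub>B\<^esub>"] B.add.r_cancel_one[of "lam s \<zero>\<^bsub>B\<^esub>" "lam s \<zero>\<^bsub>B\<^esub>"] by simp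

lemma rho_zero [simp]: "s \<in> carrier T \<Longrightarrow> rho s \<zero>\<^bsub>B\<^esub> = \<zero>\<^bsub>B\<^esub>"
  using rho_add[of s "\<zero>\<^bsub>B\<^esub>" "\<zero>\<^bsub>B\<^esub>"] B.add.r_cancel_one[of "rho s \<zero>\<^bsub>B\<^esub>" "rho s \<zero>\<^bsub>B\<^esub>"] by simp

text \<open>The zero laws are not axioms of \<open>nonunital_ring\<close>; distributivity and
  cancellation in the additive group yield them.\<close>

lemma mult_zero_left [simp]: "x \<in> carrier B \<Longrightarrow> \<zero>\<^bsub>B\<^esub> \<otimes>\<^bsub>B\<^esub> x = \<zero>\<^bsub>B\<^esub>"
  using B.l_distr[of "\<zero>\<^bsub>B\<^esub>" "\<zero>\<^bsub>B\<^esub>" x] B.m_closed[of "\<zero>\<^bsub>B\<^esub>" x]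
    B.add.r_cancel_one[of "\<zero>\<^bsub>B\<^esub> \<otimes>\<^bsub>B\<^esub> x" "\<zero>\<^bsub>B\<^esub> \<otimes>\<^bsub>B\<^esub> x"] by simp

lemma mult_zero_right [simp]: "x \<in> carrier B \<Longrightarrow> x \<otimes>\<^bsub>B\<^esub> \<zero>\<^bsub>B\<^esub> = \<zero>\<^bsub>B\<^esub>"
  using B.r_distr[of "\<zero>\<^bsub>B\<^esub>" "\<zero>\<^bsub>B\<^esub>" x] B.m_closed[of x "\<zero>\<^bsub>B\<^esub>"]
    B.add.r_cancel_one[of "x \<otimes>\<^bsub>B\<^esub> \<zero>\<^bsub>B\<^esub>" "x \<otimes>\<^bsub>B\<^esub> \<zero>\<^bsub>B\<^esub>"] by simp

section \<open>Ring structure, projection, section and restriction to ideals\<close>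

lemma abelian_group_semidirect: "abelian_group (semidirect B T lam rho)"
proof (rule abelian_groupI)
  fix x assume "x \<in> carrier (semidirect B T lam rho)"
  then show "\<exists>y \<in> carrier (semidirect B T lam rho).
      y \<oplus>\<^bsub>semidirect B T lam rho\<^esub> x = \<zero>\<^bsub>semidirect B T lam rho\<^esub>"
    by (intro bexI[of _ "(\<ominus>\<^bsub>B\<^esub> fst x, \<ominus>\<^bsub>T\<^esub> snd x)"])
      (auto simp: semidirect_def B.l_neg T.l_neg)
qed (auto simp: semidirect_def B.a_ac T.a_ac)

text \<open>Both ways of bracketing a triple product expand to seven terms in \<open>B\<close>.
  Balancedness matches \<open>rho t b\<close> times \<open>d\<close> with \<open>b\<close> times
  \<open>lam t d\<close>, commutation matches the mixed term in \<open>lam\<close> and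
  \<open>rho\<close>, and \<open>rho\<close> must reverse products to match the iterated right
  actions.\<close>

lemma ring_semidirect:
  assumes "ring T"
    and lam_one: "lam \<one>\<^bsub>T\<^esub> = \<one>\<^bsub>End_right B\<^esub>" and rho_one: "rho \<one>\<^bsub>T\<^esub> = \<one>\<^bsub>End_left B\<^esub>"
  shows "ring (semidirect B T lam rho)"
proof (rule ringI)
  interpret T': ring T by fact
  have one_apply: "lam \<one>\<^bsub>T\<^esub> x = x" "rho \<one>\<^bsub>T\<^esub> x = x" if "x \<in> carrier B" for x
    using that by (simp_all add: lam_one rho_one End_right_def End_left_def)
  show "abelian_group (semidirect B T lam rho)" by (rule abelian_group_semidirect)
  show "monoid (semidirect B T lam rho)"
    by (rule monoidI)
      (auto simp: semidirect_def one_apply B.m_closed B.m_assoc B.l_distr B.r_distr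
        T'.m_assoc B.a_ac lam_add rho_add lam_mult rho_mult lam_mult_scalar
        rho_mult_scalar lam_rho_commute rho_lam_balanced)
qed (auto simp: semidirect_def B.m_closed B.l_distr B.r_distr T.l_distr T.r_distr
    B.a_ac lam_add rho_add lam_add_scalar rho_add_scalar)

lemma snd_ring_hom_semidirect: "snd \<in> ring_hom (semidirect B T lam rho) T"
  by (rule ring_hom_memI) (auto simp: semidirect_def)

text \<open>With first components zero, the cross terms \<open>lam s \<zero>\<close> and
  \<open>rho t \<zero>\<close> vanish.\<close>

lemma Pair_zero_ring_hom_semidirect: "Pair \<zero>\<^bsub>B\<^esub> \<in> ring_hom T (semidirect B T lam rho)"
  by (rule ring_hom_memI) (auto simp: semidirect_def)

text \<open>An ideal is closed under sums, negatives and products, and the laws of the actions are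
  inherited from \<open>T\<close>. This gives meaning to the semidirect product with the maximal
  ideal.\<close>

lemma semidirect_data_restrict:
  assumes "ideal I T"
  shows "semidirect_data B (T\<lparr>carrier := I\<rparr>) (restrict lam I) (restrict rho I)"
proof -
  interpret I: ideal I T by fact
  have "abelian_group (T\<lparr>carrier := I\<rparr>)"
  proof (rule abelian_groupI)
    fix x assume "x \<in> carrier (T\<lparr>carrier := I\<rparr>)"
    then show "\<exists>y \<in> carrier (T\<lparr>carrier := I\<rparr>). y \<oplus>\<^bsub>T\<lparr>carrier := I\<rparr>\<^esub> x = \<zero>\<^bsub>T\<lparr>carrier := I\<rparr>\<^esub>"
      by (intro bexI[of _ "\<ominus>\<^bsub>T\<^esub> x"]) (simp_all add: I.Icarr T.l_neg)
  qed (auto simp: I.Icarr T.a_ac)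
  then have "nonunital_ring (T\<lparr>carrier := I\<rparr>)"
    by (intro nonunital_ring.intro nonunital_ring_axioms.intro)
      (simp_all add: I.Icarr I.I_l_closed T.m_assoc T.l_distr T.r_distr)
  moreover have "semidirect_data_axioms B (T\<lparr>carrier := I\<rparr>) (restrict lam I) (restrict rho I)"
  proof
    show "restrict lam I \<in> nonunital_ring_hom (T\<lparr>carrier := I\<rparr>) (End_right B)"
      using lam_hom I.Icarr I.I_l_closed by (auto simp: nonunital_ring_hom_def)
    show "restrict rho I \<in> nonunital_ring_antihom (T\<lparr>carrier := I\<rparr>) (End_left B)"
      using rho_antihom I.Icarr I.I_l_closed by (auto simp: nonunital_ring_antihom_def)
  qed (simp_all add: I.Icarr lam_rho_commute rho_lam_balanced)
  ultimately show ?thesis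
    by (intro semidirect_data.intro B.nonunital_ring_axioms)
qed

end

theorem proposition4p1:
  fixes R :: "('r, 'm) ring_scheme" and S :: "('s, 'n) ring_scheme"
    and \<mm> \<kappa> :: "'r set" and lam rho :: "'r \<Rightarrow> 's \<Rightarrow> 's"
  assumes "ring R"
    and "exhibits_star R \<mm> \<kappa>"
    and "ring S"
    and "semidirect_data S R lam rho"
    and "lam \<one>\<^bsub>R\<^esub> = \<one>\<^bsub>End_right S\<^esub>"
    and "rho \<one>\<^bsub>R\<^esub> = \<one>\<^bsub>End_left S\<^esub>"
  shows "ring (semidirect S R lam rho) \<and>
    property_star (semidirect S R lam rho) \<and>
    semidirect_data S (R\<lparr>carrier := \<mm>\<rparr>) (restrict lam \<mm>) (restrict rho \<mm>) \<and>
    carrier (semidirect S (R\<lparr>carrier := \<mm>\<rparr>) (restrict lam \<mm>) (restrict rho \<mm>))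
      = {(s, x). s \<in> carrier S \<and> x \<in> \<mm>} \<and>
    (\<lambda>u. (\<zero>\<^bsub>S\<^esub>, u)) \<in> ring_iso (R\<lparr>carrier := \<kappa>\<rparr>)
      ((semidirect S R lam rho)\<lparr>carrier := {(\<zero>\<^bsub>S\<^esub>, u) | u. u \<in> \<kappa>}\<rparr>) \<and>
    exhibits_star (semidirect S R lam rho)
      (carrier (semidirect S (R\<lparr>carrier := \<mm>\<rparr>) (restrict lam \<mm>) (restrict rho \<mm>)))
      {(\<zero>\<^bsub>S\<^esub>, u) | u. u \<in> \<kappa>}"
proof -
  let ?M = "semidirect S R lam rho"
  let ?I = "carrier (semidirect S (R\<lparr>carrier := \<mm>\<rparr>) (restrict lam \<mm>) (restrict rho \<mm>))"
  let ?\<iota> = "Pair \<zero>\<^bsub>S\<^esub> :: 'r \<Rightarrow> 's \<times> 'r"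
  interpret sd: semidirect_data S R lam rho by fact
  have M: "ring ?M" by (rule sd.ring_semidirect[OF assms(1,5,6)])
  interpret p: ring_hom_ring ?M R snd
    by (rule ring_hom_ringI2[OF M assms(1) sd.snd_ring_hom_semidirect])
  have max: "maximalideal \<mm> R" and "subfield \<kappa> R"
    using assms(2) by (simp_all add: exhibits_star_def)
  then have ideal: "ideal \<mm> R" and \<kappa>_sub: "\<kappa> \<subseteq> carrier R"
    by (auto dest: maximalideal.axioms(1) subfieldE(3))
  have I: "?I = {(s, x). s \<in> carrier S \<and> x \<in> \<mm>}"
    by (auto simp: semidirect_def)
  \<comment> \<open>As \<open>\<mm>\<close> lies in \<open>R\<close>, this set is the preimage of
    \<open>\<mm>\<close> under the projection, the form in which \<open>exhibits_star_vimage\<close>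
    delivers the maximal ideal.\<close>
  also have "\<dots> = {z \<in> carrier ?M. snd z \<in> \<mm>}"
    using ideal.Icarr[OF ideal] by (auto simp: semidirect_def)
  finally have vimage: "?I = {z \<in> carrier ?M. snd z \<in> \<mm>}" .
  have image: "{(\<zero>\<^bsub>S\<^esub>, u) | u. u \<in> \<kappa>} = ?\<iota> ` \<kappa>" by auto
  have star: "exhibits_star ?M ?I {(\<zero>\<^bsub>S\<^esub>, u) | u. u \<in> \<kappa>}"
    unfolding vimage image
    by (rule p.exhibits_star_vimage[OF assms(2) sd.Pair_zero_ring_hom_semidirect]) simp
  \<comment> \<open>The homomorphism laws hold on \<open>R\<close>, hence on
    \<open>\<kappa>\<close>, and the second component recovers \<open>u\<close>.\<close>
  have "?\<iota> \<in> ring_iso (R\<lparr>carrier := \<kappa>\<rparr>) (?M\<lparr>carrier := ?\<iota> ` \<kappa>\<rparr>)"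
    using sd.Pair_zero_ring_hom_semidirect \<kappa>_sub
    by (intro ring_iso_memI)
      (auto simp: ring_hom_def bij_betw_def inj_on_def subset_iff)
  then show ?thesis
    using M star I sd.semidirect_data_restrict[OF ideal]
    unfolding image property_star_def by blast
qed

end
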